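(* For any $A, B \in \mathbb{P}_{n}$, $$d(A, B) \leq \delta(A, B).$$ The equality holds for commuting matrices $A, B \in \mathbb{P}_{n}$.
   Context: $\mathbb{P}_{n}$ is the set of $n \times n$ positive definite Hermitian complex matrices and $\Vert \cdot \Vert_{2}$ is the Frobenius norm. For $A, B \in \mathbb{P}_n$, $A \# B := A^{1/2} (A^{-1/2} B A^{-1/2})^{1/2} A^{1/2}$, $d(A, B) := 2 \Vert \log (A^{-1} \# B) \Vert_{2}$, and $\delta(A, B) := \Vert \log (A^{-1/2} B A^{-1/2}) \Vert_{2}$ is the Riemannian trace metric. *)

theory Defs
  imports
    "Jordan_Normal_Form.Gauss_Jordan_Elimination"
    "Jordan_Normal_Form.Schur_Decomposition"
begin

text \<open>Here \<open>v \<bullet>c w\<close> is \<open>\<Sum>i. v\<^sub>i * cnj w\<^sub>i\<close> and the order on the complex numbers is that of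
  \<^theory>\<open>HOL-Library.Complex_Order\<close>, so \<open>0 < z\<close> says that \<open>z\<close> is real and positive.\<close>

definition pos_def_mats :: "nat \<Rightarrow> complex mat set" where
  "pos_def_mats n = {A \<in> carrier_mat n n. mat_adjoint A = A \<and>
     (\<forall>v \<in> carrier_vec n. v \<noteq> 0\<^sub>v n \<longrightarrow> 0 < (A *\<^sub>v v) \<bullet>c v)}"

definition frobenius_norm :: "complex mat \<Rightarrow> real" where
  "frobenius_norm A = sqrt (\<Sum>i<dim_row A. \<Sum>j<dim_col A. (cmod (A $$ (i, j)))\<^sup>2)"

definition unitary_mats :: "nat \<Rightarrow> complex mat set" where
  "unitary_mats n = {U \<in> carrier_mat n n. U * mat_adjoint U = 1\<^sub>m n \<and> mat_adjoint U * U = 1\<^sub>m n}"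

definition real_diag :: "nat \<Rightarrow> (nat \<Rightarrow> real) \<Rightarrow> complex mat" where
  "real_diag n d = mat_diag n (\<lambda>i. complex_of_real (d i))"

text \<open>The functional calculus of a Hermitian matrix \<open>A\<close>: if \<open>A = U D U\<^sup>*\<close> with \<open>U\<close> unitary and
  \<open>D\<close> the diagonal matrix with real entries \<open>d 0, \<dots>, d (n - 1)\<close>, then \<open>f(A)\<close> is
  \<open>U f(D) U\<^sup>*\<close>. Such a diagonalisation exists by the spectral theorem, and the lemma
  \<open>herm_fun_eq\<close> shows that the result does not depend on its choice.\<close>

definition herm_fun :: "(real \<Rightarrow> real) \<Rightarrow> complex mat \<Rightarrow> complex mat" where
  "herm_fun f A = (THE X. \<exists>U \<in> unitary_mats (dim_row A). \<exists>d.
     A = U * real_diag (dim_row A) d * mat_adjoint U \<and>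
     X = U * real_diag (dim_row A) (\<lambda>i. f (d i)) * mat_adjoint U)"

lemma mat_adjoint_carrier: "U \<in> carrier_mat n m \<Longrightarrow> mat_adjoint U \<in> carrier_mat m n"
  by (auto simp: mat_adjoint_def)

lemma herm_fun_unique:
  assumes U: "U \<in> unitary_mats n" and V: "V \<in> unitary_mats n"
    and eq: "U * real_diag n d * mat_adjoint U = V * real_diag n e * mat_adjoint V"
  shows "U * real_diag n (\<lambda>i. f (d i)) * mat_adjoint U
       = V * real_diag n (\<lambda>i. f (e i)) * mat_adjoint V"
proof -
  have Uc: "U \<in> carrier_mat n n" and Vc: "V \<in> carrier_mat n n"
    and U1: "U * mat_adjoint U = 1\<^sub>m n" "mat_adjoint U * U = 1\<^sub>m n"
    and V1: "V * mat_adjoint V = 1\<^sub>m n" "mat_adjoint V * V = 1\<^sub>m n"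
    using U V by (auto simp: unitary_mats_def)
  have U': "mat_adjoint U \<in> carrier_mat n n" and V': "mat_adjoint V \<in> carrier_mat n n"
    using Uc Vc by (auto intro: mat_adjoint_carrier)
  have D: "real_diag n g \<in> carrier_mat n n" for g by (simp add: real_diag_def)
  define W where "W = mat_adjoint V * U"
  have W: "W \<in> carrier_mat n n" using V' Uc by (simp add: W_def)
  have step: "W * real_diag n g = mat_adjoint V * (U * real_diag n g * mat_adjoint U) * U" for g
  proof -
    have "U * real_diag n g = U * real_diag n g * (mat_adjoint U * U)"
      using Uc D[of g] by (simp add: U1)
    also have "\<dots> = U * real_diag n g * mat_adjoint U * U"
      using Uc U' D[of g] by (intro assoc_mult_mat[symmetric]) auto
    finally have *: "U * real_diag n g = U * real_diag n g * mat_adjoint U * U" .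
    have "W * real_diag n g = mat_adjoint V * (U * real_diag n g)"
      unfolding W_def using V' Uc D[of g] by (intro assoc_mult_mat) auto
    also have "\<dots> = mat_adjoint V * (U * real_diag n g * mat_adjoint U * U)"
      using * by simp
    also have "\<dots> = mat_adjoint V * (U * real_diag n g * mat_adjoint U) * U"
      using V' Uc U' D[of g] by (intro assoc_mult_mat[symmetric]) auto
    finally show ?thesis .
  qed
  have step2: "real_diag n g * W = mat_adjoint V * (V * real_diag n g * mat_adjoint V) * U" for g
  proof -
    have "mat_adjoint V * (V * real_diag n g * mat_adjoint V)
        = mat_adjoint V * (V * (real_diag n g * mat_adjoint V))"
      using V' Vc D[of g] by (simp add: assoc_mult_mat[of V n n])
    also have "\<dots> = mat_adjoint V * V * (real_diag n g * mat_adjoint V)"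
      using V' Vc D[of g] by (intro assoc_mult_mat[symmetric]) auto
    also have "\<dots> = real_diag n g * mat_adjoint V"
      using V' D[of g] by (simp add: V1)
    finally show ?thesis
      unfolding W_def using V' Uc D[of g] by (simp add: assoc_mult_mat[of _ n n])
  qed
  have "W * real_diag n d = real_diag n e * W"
    using step[of d] step2[of e] eq by simp
  then have ent: "W $$ (i, j) * complex_of_real (d j) = complex_of_real (e i) * W $$ (i, j)"
    if "i < n" "j < n" for i j
    using that W by (auto simp: real_diag_def mat_diag_mult_left mat_diag_mult_right
        dest!: arg_cong[where f = "\<lambda>M. M $$ (i, j)"])
  have "W * real_diag n (\<lambda>i. f (d i)) = real_diag n (\<lambda>i. f (e i)) * W"
  proof (rule eq_matI)
    fix i j
    assume "i < dim_row (real_diag n (\<lambda>i. f (e i)) * W)"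
      and "j < dim_col (real_diag n (\<lambda>i. f (e i)) * W)"
    then have ij: "i < n" "j < n" using W D by (auto simp: real_diag_def mat_diag_def)
    have "W $$ (i, j) = 0 \<or> d j = e i"
      using ent[OF ij] by (auto simp: mult.commute)
    then show "(W * real_diag n (\<lambda>i. f (d i))) $$ (i, j)
        = (real_diag n (\<lambda>i. f (e i)) * W) $$ (i, j)"
      using ij W by (auto simp: real_diag_def mat_diag_mult_left mat_diag_mult_right)
  qed (use W D in \<open>auto simp: real_diag_def mat_diag_def\<close>)
  then have key: "mat_adjoint V * (U * real_diag n (\<lambda>i. f (d i)) * mat_adjoint U) * U
      = mat_adjoint V * (V * real_diag n (\<lambda>i. f (e i)) * mat_adjoint V) * U"
    using step step2 by simp
  have cancel: "V * (mat_adjoint V * X * U) * mat_adjoint U = X" if X: "X \<in> carrier_mat n n" for X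
  proof -
    have "V * (mat_adjoint V * X * U) * mat_adjoint U
        = V * mat_adjoint V * (X * (U * mat_adjoint U))"
      using V' Vc Uc U' X by (simp add: assoc_mult_mat[of _ n n _ n _ n])
    then show ?thesis using X by (simp add: U1 V1)
  qed
  have "U * real_diag n (\<lambda>i. f (d i)) * mat_adjoint U \<in> carrier_mat n n"
    "V * real_diag n (\<lambda>i. f (e i)) * mat_adjoint V \<in> carrier_mat n n"
    using Uc U' Vc V' D by auto
  from cancel[OF this(1), unfolded key] cancel[OF this(2)] show ?thesis by (rule trans[OF sym])
qed

lemma herm_fun_eq:
  assumes U: "U \<in> unitary_mats n"
  shows "herm_fun f (U * real_diag n d * mat_adjoint U)
       = U * real_diag n (\<lambda>i. f (d i)) * mat_adjoint U"
proof -
  have n: "dim_row (U * real_diag n d * mat_adjoint U) = n"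
    using U by (auto simp: unitary_mats_def)
  show ?thesis
    unfolding herm_fun_def n
    by (rule the_equality) (use U in \<open>auto intro: herm_fun_unique\<close>)
qed

definition mat_rpow :: "complex mat \<Rightarrow> real \<Rightarrow> complex mat" where
  "mat_rpow A t = herm_fun (\<lambda>x. x powr t) A"

definition mat_log :: "complex mat \<Rightarrow> complex mat" where
  "mat_log A = herm_fun ln A"

definition mat_inv :: "complex mat \<Rightarrow> complex mat" where
  "mat_inv A = the (mat_inverse A)"

definition geometric_mean :: "complex mat \<Rightarrow> complex mat \<Rightarrow> complex mat" where
  "geometric_mean A B =
     mat_rpow A (1/2) * mat_rpow (mat_rpow A (-1/2) * B * mat_rpow A (-1/2)) (1/2) * mat_rpow A (1/2)"

definition spectral_dist :: "complex mat \<Rightarrow> complex mat \<Rightarrow> real" where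
  "spectral_dist A B = 2 * frobenius_norm (mat_log (geometric_mean (mat_inv A) B))"

definition trace_dist :: "complex mat \<Rightarrow> complex mat \<Rightarrow> real" where
  "trace_dist A B = frobenius_norm (mat_log (mat_rpow A (-1/2) * B * mat_rpow A (-1/2)))"

end

theory Submission
  imports Defs "Jordan_Normal_Form.Char_Poly"
begin

text \<open>\<open>G = A\<^sup>-\<^sup>1 # B\<close> satisfies \<open>G A G = B\<close>, so \<open>P = A\<^sup>-\<^sup>1\<^sup>/\<^sup>2 B A\<^sup>-\<^sup>1\<^sup>/\<^sup>2\<close> equals \<open>M\<^sup>* M\<close> for the matrix
  \<open>M = A\<^sup>1\<^sup>/\<^sup>2 G A\<^sup>-\<^sup>1\<^sup>/\<^sup>2\<close>, which is similar to \<open>G\<close>. The theorem thus compares the eigenvalues \<open>g\<close> of \<open>M\<close>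
  with its squared singular values \<open>s\<close>, and follows from Weyl's log-majorisation of \<open>g\<^sup>2\<close> by \<open>s\<close>.

  The majorisation is obtained in the form \<open>\<Prod>i max (g i\<^sup>2) c \<le> \<Prod>i max (s i) c\<close> for all \<open>c > 0\<close>. Let \<open>K\<close>
  have eigenvectors of \<open>M\<close> as columns, so that \<open>K\<^sup>* P K = diag g \<cdot> K\<^sup>* K \<cdot> diag g\<close>. Replacing every eigenvalue
  of \<open>P\<close> below \<open>c\<close> by \<open>c\<close> gives a matrix \<open>P'\<close> with \<open>P' \<ge> P\<close> and \<open>P' \<ge> c\<close>. The pivots of a Cholesky
  factorisation are monotone in the Loewner order, so if \<open>h\<close> are the pivots of \<open>K\<^sup>* K\<close>, then the pivots of
  \<open>K\<^sup>* P' K\<close> are at least \<open>g i\<^sup>2 h i\<close> and at least \<open>c h i\<close>. Compare determinants.\<close>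

section \<open>Adjoints, diagonal matrices and quadratic forms\<close>

lemma mat_adjoint_dim [simp]:
  "dim_row (mat_adjoint A) = dim_col A" "dim_col (mat_adjoint A) = dim_row A"
  by (auto simp: mat_adjoint_def)

lemma mat_adjoint_index [simp]:
  fixes A :: "complex mat"
  assumes "i < dim_col A" "j < dim_row A"
  shows "mat_adjoint A $$ (i, j) = cnj (A $$ (j, i))"
  using assms by (simp add: mat_adjoint_def mat_of_rows_index)

lemma mat_adjoint_adjoint [simp]: "mat_adjoint (mat_adjoint A) = (A :: complex mat)"
  by (rule eq_matI) auto

lemma mat_adjoint_one [simp]: "mat_adjoint (1\<^sub>m n) = (1\<^sub>m n :: complex mat)"
  by (rule eq_matI) auto

lemma mat_adjoint_mult:
  fixes A B :: "complex mat"
  assumes "A \<in> carrier_mat n m" "B \<in> carrier_mat m k"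
  shows "mat_adjoint (A * B) = mat_adjoint B * mat_adjoint A"
  using assms by (intro eq_matI) (auto simp: scalar_prod_def mult.commute)

lemma mat_adjoint_det:
  fixes A :: "complex mat"
  assumes "A \<in> carrier_mat n n"
  shows "det (mat_adjoint A) = cnj (det A)"
proof -
  interpret comm_ring_hom cnj by unfold_locales auto
  have "mat_adjoint A = transpose_mat (map_mat cnj A)"
    by (rule eq_matI) auto
  then show ?thesis
    using assms by (simp add: det_transpose[of _ n])
qed

lemma real_diag_carrier [simp]: "real_diag n d \<in> carrier_mat n n"
  by (simp add: real_diag_def)

lemma real_diag_dim [simp]: "dim_row (real_diag n d) = n" "dim_col (real_diag n d) = n"
  using real_diag_carrier[of n d] by (auto simp del: real_diag_carrier)

lemma real_diag_index:
  "i < n \<Longrightarrow> j < n \<Longrightarrow> real_diag n d $$ (i, j) = (if i = j then complex_of_real (d i) else 0)"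
  by (simp add: real_diag_def mat_diag_def)

lemma real_diag_adjoint [simp]: "mat_adjoint (real_diag n d) = real_diag n d"
  by (rule eq_matI) (auto simp: real_diag_index)

lemma real_diag_mult: "real_diag n d * real_diag n e = real_diag n (\<lambda>i. d i * e i)"
  by (simp add: real_diag_def)

lemma real_diag_one: "(\<And>i. i < n \<Longrightarrow> d i = 1) \<Longrightarrow> real_diag n d = 1\<^sub>m n"
  by (rule eq_matI) (auto simp: real_diag_index)

lemma real_diag_det: "det (real_diag n d) = complex_of_real (\<Prod>i<n. d i)"
proof -
  have "det (real_diag n d) = prod_list (diag_mat (real_diag n d))"
    by (rule det_upper_triangular[of _ n]) (auto simp: real_diag_index)
  also have "\<dots> = (\<Prod>i = 0..<n. real_diag n d $$ (i, i))"
    by (simp add: prod_list_diag_prod)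
  also have "\<dots> = (\<Prod>i<n. complex_of_real (d i))"
    by (simp add: real_diag_index lessThan_atLeast0)
  finally show ?thesis by simp
qed

lemma mult_mat_index_sum:
  assumes "A \<in> carrier_mat n m" "B \<in> carrier_mat m k" "i < n" "j < k"
  shows "(A * B) $$ (i, j) = (\<Sum>l<m. A $$ (i, l) * B $$ (l, j))"
  using assms by (simp add: scalar_prod_def lessThan_atLeast0)

lemma inner_adjoint:
  fixes A :: "complex mat"
  assumes "A \<in> carrier_mat n m" "u \<in> carrier_vec m" "v \<in> carrier_vec n"
  shows "(A *\<^sub>v u) \<bullet>c v = u \<bullet>c (mat_adjoint A *\<^sub>v v)"
proof -
  have "(A *\<^sub>v u) \<bullet>c v = (\<Sum>i<n. \<Sum>j<m. A $$ (i, j) * u $ j * cnj (v $ i))"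
    using assms by (simp add: scalar_prod_def lessThan_atLeast0 sum_distrib_right)
  also have "\<dots> = (\<Sum>j<m. \<Sum>i<n. A $$ (i, j) * u $ j * cnj (v $ i))"
    by (rule sum.swap)
  also have "\<dots> = u \<bullet>c (mat_adjoint A *\<^sub>v v)"
    using assms
    by (simp add: scalar_prod_def lessThan_atLeast0 sum_distrib_left mult_ac)
  finally show ?thesis .
qed

lemma quadratic_form_congruence:
  fixes X K :: "complex mat"
  assumes "X \<in> carrier_mat n n" "K \<in> carrier_mat n m" "v \<in> carrier_vec m"
  shows "((mat_adjoint K * X * K) *\<^sub>v v) \<bullet>c v = (X *\<^sub>v (K *\<^sub>v v)) \<bullet>c (K *\<^sub>v v)"
proof -
  have K': "mat_adjoint K \<in> carrier_mat m n" using assms by (auto simp: mat_adjoint_carrier)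
  have "(mat_adjoint K * X * K) *\<^sub>v v = mat_adjoint K *\<^sub>v (X *\<^sub>v (K *\<^sub>v v))"
    using assms K' by (simp add: assoc_mult_mat_vec[of _ m n _ m] assoc_mult_mat_vec[of _ m n _ n])
  then show ?thesis
    using inner_adjoint[OF K', of "X *\<^sub>v (K *\<^sub>v v)" v] assms by simp
qed

lemma quadratic_form_sum:
  fixes X :: "complex mat"
  assumes "X \<in> carrier_mat n n" "v \<in> carrier_vec n"
  shows "(X *\<^sub>v v) \<bullet>c v = (\<Sum>i<n. \<Sum>j<n. X $$ (i, j) * v $ j * cnj (v $ i))"
  using assms by (simp add: scalar_prod_def lessThan_atLeast0 sum_distrib_right)

lemma quadratic_form_real_diag:
  assumes "v \<in> carrier_vec n"
  shows "(real_diag n d *\<^sub>v v) \<bullet>c v = complex_of_real (\<Sum>i<n. d i * (cmod (v $ i))\<^sup>2)"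
proof -
  have "(\<Sum>j<n. real_diag n d $$ (i, j) * v $ j * cnj (v $ i))
      = complex_of_real (d i * (cmod (v $ i))\<^sup>2)" if "i < n" for i
  proof -
    have "(\<Sum>j<n. real_diag n d $$ (i, j) * v $ j * cnj (v $ i))
        = (\<Sum>j<n. if j = i then complex_of_real (d i) * (v $ i * cnj (v $ i)) else 0)"
      using that by (intro sum.cong) (auto simp: real_diag_index)
    also have "\<dots> = complex_of_real (d i) * (v $ i * cnj (v $ i))"
      using that by simp
    finally show ?thesis by (simp add: complex_mult_cnj cmod_power2)
  qed
  then show ?thesis using assms by (simp add: quadratic_form_sum[of _ n])
qed

lemma vec_neq_zero_index:
  assumes "v \<in> carrier_vec n" "v \<noteq> 0\<^sub>v n"
  obtains i where "i < n" "v $ i \<noteq> 0"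
  using assms by (metis carrier_vecD eq_vecI index_zero_vec(1) index_zero_vec(2))

lemma real_diag_pos_def:
  assumes "\<And>i. i < n \<Longrightarrow> 0 < d i"
  shows "real_diag n d \<in> pos_def_mats n"
proof -
  have "0 < (\<Sum>i<n. d i * (cmod (v $ i))\<^sup>2)" if v: "v \<in> carrier_vec n" "v \<noteq> 0\<^sub>v n" for v
  proof -
    obtain i where i: "i < n" "v $ i \<noteq> 0" using v by (rule vec_neq_zero_index)
    show ?thesis
      by (rule sum_pos2[of _ i]) (use i assms in \<open>auto simp: less_imp_le\<close>)
  qed
  then show ?thesis
    by (auto simp: pos_def_mats_def quadratic_form_real_diag less_complex_def)
qed

text \<open>The form of the new matrix at \<open>v\<close> is the form of \<open>X\<close> at
  \<open>K v\<close>, and the left inverse \<open>L\<close> keeps \<open>K v\<close>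
  nonzero.\<close>

lemma pos_def_congruence:
  assumes X: "X \<in> pos_def_mats n" and K: "K \<in> carrier_mat n n" "L \<in> carrier_mat n n"
    and inv: "L * K = 1\<^sub>m n"
  shows "mat_adjoint K * X * K \<in> pos_def_mats n"
proof -
  have Xc: "X \<in> carrier_mat n n" and XH: "mat_adjoint X = X"
    and Xp: "\<And>v. v \<in> carrier_vec n \<Longrightarrow> v \<noteq> 0\<^sub>v n \<Longrightarrow> 0 < (X *\<^sub>v v) \<bullet>c v"
    using X by (auto simp: pos_def_mats_def)
  have K': "mat_adjoint K \<in> carrier_mat n n" using K by (auto simp: mat_adjoint_carrier)
  have "mat_adjoint (mat_adjoint K * X * K) = mat_adjoint K * X * K"
    using K K' Xc by (simp add: mat_adjoint_mult[of _ n n _ n] XH assoc_mult_mat[of _ n n _ n _ n])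
  moreover have "0 < ((mat_adjoint K * X * K) *\<^sub>v v) \<bullet>c v"
    if v: "v \<in> carrier_vec n" "v \<noteq> 0\<^sub>v n" for v
  proof -
    have "K *\<^sub>v v \<noteq> 0\<^sub>v n"
    proof
      assume 0: "K *\<^sub>v v = 0\<^sub>v n"
      have "v = (L * K) *\<^sub>v v" using v inv by simp
      also have "\<dots> = L *\<^sub>v (K *\<^sub>v v)" using K v by simp
      also have "\<dots> = 0\<^sub>v n" using K 0 by (auto intro!: eq_vecI)
      finally show False using v by simp
    qed
    then show ?thesis
      using Xp[of "K *\<^sub>v v"] v K by (simp add: quadratic_form_congruence[OF Xc K(1) v(1)])
  qed
  ultimately show ?thesis using K K' Xc by (auto simp: pos_def_mats_def)
qed

section \<open>Cholesky factorisation\<close>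

definition unit_upper :: "nat \<Rightarrow> complex mat set" where
  "unit_upper n = {R \<in> carrier_mat n n. upper_triangular R \<and> (\<forall>i<n. R $$ (i, i) = 1)}"

text \<open>A term \<open>A $$ (i, l) * B $$ (l, j)\<close> can be nonzero only for i \<le> l \<le>
  j: never below the diagonal, and only for l = i on it.\<close>

lemma upper_triangular_mult:
  assumes A: "A \<in> carrier_mat n n" "upper_triangular A"
    and B: "B \<in> carrier_mat n n" "upper_triangular B"
  shows "upper_triangular (A * B)"
    and "i < n \<Longrightarrow> (A * B) $$ (i, i) = A $$ (i, i) * B $$ (i, i)"
proof -
  show "upper_triangular (A * B)"
  proof (rule upper_triangularI)
    fix i j assume ij: "j < i" "i < dim_row (A * B)"
    have "A $$ (i, l) * B $$ (l, j) = 0" if "l < n" for l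
      using upper_triangularD[OF A(2), of l i] upper_triangularD[OF B(2), of j l] ij A B that
      by (cases "l < i") auto
    then show "(A * B) $$ (i, j) = 0"
      using ij A B by (simp del: index_mult_mat(1) add: mult_mat_index_sum[of _ n n _ n])
  qed
  assume i: "i < n"
  have "A $$ (i, l) * B $$ (l, i) = 0" if "l < n" "l \<noteq> i" for l
    using upper_triangularD[OF A(2), of l i] upper_triangularD[OF B(2), of i l] i A B that
    by (cases "l < i") auto
  then show "(A * B) $$ (i, i) = A $$ (i, i) * B $$ (i, i)"
    using i A B by (simp del: index_mult_mat(1) add: mult_mat_index_sum[of _ n n _ n] sum.remove[of _ i])
qed

lemma unit_upper_det: "R \<in> unit_upper n \<Longrightarrow> det R = 1"
  by (subst det_upper_triangular[of _ n])
    (auto simp: unit_upper_def prod_list_diag_prod)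

lemma det_nonzero_inverse:
  fixes A :: "complex mat"
  assumes "A \<in> carrier_mat n n" "det A \<noteq> 0"
  obtains B where "B \<in> carrier_mat n n" "A * B = 1\<^sub>m n" "B * A = 1\<^sub>m n"
  using det_non_zero_imp_unit[OF assms, of undefined] by (auto simp: Units_def ring_mat_def)

lemma unit_upper_inverse:
  assumes "R \<in> unit_upper n"
  obtains S where "S \<in> unit_upper n" "R * S = 1\<^sub>m n" "S * R = 1\<^sub>m n"
proof -
  have R: "R \<in> carrier_mat n n" "upper_triangular R" and R1: "\<And>i. i < n \<Longrightarrow> R $$ (i, i) = 1"
    using assms by (auto simp: unit_upper_def)
  obtain S where S: "S \<in> carrier_mat n n" "R * S = 1\<^sub>m n" "S * R = 1\<^sub>m n"
    using det_nonzero_inverse[OF R(1)] unit_upper_det[OF assms] by auto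
  \<comment> \<open>Back substitution from the last row upwards. In entry \<open>(i, j)\<close> of
    \<open>R * S = 1\<close>, the terms with l < i vanish because \<open>R\<close> is triangular,
    those with l > i because row \<open>l\<close> of \<open>S\<close> is already known.\<close>
  have *: "S $$ (i, j) = (1\<^sub>m n :: complex mat) $$ (i, j)" if "j \<le> i" "i < n" for i j
    using that
  proof (induction "n - i" arbitrary: i rule: less_induct)
    case less
    have "R $$ (i, l) * S $$ (l, j) = 0" if "l < n" "l \<noteq> i" for l
      using less.hyps[of l] less.prems that upper_triangularD[OF R(2), of l i] R
      by (cases "l < i") auto
    then have "(\<Sum>l\<in>{..<n} - {i}. R $$ (i, l) * S $$ (l, j)) = 0"
      by (intro sum.neutral) auto
    then have "(R * S) $$ (i, j) = S $$ (i, j)"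
      using less.prems R S(1) by (simp del: index_mult_mat(1)
          add: mult_mat_index_sum[of _ n n _ n] sum.remove[of _ i] R1)
    then show ?case using S by simp
  qed
  have "S \<in> unit_upper n" using S(1) * by (auto simp: unit_upper_def)
  then show ?thesis using S that by blast
qed

lemma congruence_real_diag_index:
  fixes R :: "complex mat"
  assumes "R \<in> carrier_mat n n" "i < n" "j < n"
  shows "(mat_adjoint R * real_diag n p * R) $$ (i, j)
    = (\<Sum>k<n. cnj (R $$ (k, i)) * complex_of_real (p k) * R $$ (k, j))"
proof -
  have R': "mat_adjoint R \<in> carrier_mat n n" using assms by (simp add: mat_adjoint_carrier)
  have "(mat_adjoint R * real_diag n p) $$ (i, k) = cnj (R $$ (k, i)) * complex_of_real (p k)"
    if "k < n" for k
    using assms that by (simp add: real_diag_def mat_diag_mult_right[OF R'])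
  moreover have "mat_adjoint R * real_diag n p \<in> carrier_mat n n"
    using R' by (rule mult_carrier_mat) simp
  ultimately show ?thesis
    using assms(1) by (simp add: mult_mat_index_sum[OF _ assms] del: index_mult_mat(1))
qed

text \<open>Gaussian elimination of the first row and column leaves the Schur complement \<open>C\<close>.\<close>

lemma cholesky:
  assumes "X \<in> pos_def_mats n"
  shows "\<exists>R \<in> unit_upper n. \<exists>p. (\<forall>i. 0 < p i) \<and> X = mat_adjoint R * real_diag n p * R"
  using assms
proof (induction n arbitrary: X)
  case 0
  then show ?case
    by (intro bexI[of _ "1\<^sub>m 0"] exI[of _ "\<lambda>_. 1"])
      (auto simp: pos_def_mats_def unit_upper_def intro!: eq_matI)
next
  case (Suc n)
  have Xc: "X \<in> carrier_mat (Suc n) (Suc n)" and XH: "mat_adjoint X = X"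
    and Xp: "\<And>v. v \<in> carrier_vec (Suc n) \<Longrightarrow> v \<noteq> 0\<^sub>v (Suc n) \<Longrightarrow> 0 < (X *\<^sub>v v) \<bullet>c v"
    using Suc.prems by (auto simp: pos_def_mats_def)
  have cnjX: "cnj (X $$ (i, j)) = X $$ (j, i)" if "i < Suc n" "j < Suc n" for i j
    using mat_adjoint_index[of j X i] XH Xc that by auto
  define x where "x i j = X $$ (i, j)" for i j
  have "(X *\<^sub>v unit_vec (Suc n) 0) \<bullet>c unit_vec (Suc n) 0 = x 0 0"
    using Xc by (subst quadratic_form_sum[of _ "Suc n"]) 
      (auto simp del: sum.lessThan_Suc simp: x_def unit_vec_def sum.lessThan_Suc_shift)
  then have "0 < x 0 0" using Xp[of "unit_vec (Suc n) 0"]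
    by (metis unit_vec_carrier unit_vec_nonzero zero_less_Suc)
  then have "x 0 0 = complex_of_real (Re (x 0 0))" "0 < Re (x 0 0)"
    by (auto simp: less_complex_def complex_eq_iff)
  then obtain a where a: "x 0 0 = complex_of_real a" "0 < a" by blast
  define C where "C = mat n n (\<lambda>(i, j). x (Suc i) (Suc j) - x (Suc i) 0 * x 0 (Suc j) / a)"
  have C: "C \<in> carrier_mat n n" by (simp add: C_def)
  have "C \<in> pos_def_mats n"
  proof -
    have "mat_adjoint C = C"
      using C cnjX by (intro eq_matI) (auto simp: C_def x_def)
    moreover have "0 < (C *\<^sub>v v) \<bullet>c v" if v: "v \<in> carrier_vec n" "v \<noteq> 0\<^sub>v n" for v
    proof -
      define b where "b = (\<Sum>j<n. x 0 (Suc j) * v $ j)"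
      \<comment> \<open>Completing the square: \<open>w0\<close> solves
        \<open>a * w0 + b = 0\<close>, so the form of \<open>X\<close> at the extended vector
        \<open>w\<close> is exactly the form of the Schur complement at \<open>v\<close>.\<close>
      define w0 where "w0 = - b / a"
      define w where "w = vec (Suc n) (\<lambda>i. case i of 0 \<Rightarrow> w0 | Suc i \<Rightarrow> v $ i)"
      obtain i where i: "i < n" "v $ i \<noteq> 0" using v by (rule vec_neq_zero_index)
      have "w $ Suc i \<noteq> 0\<^sub>v (Suc n) $ Suc i" using i by (simp add: w_def)
      then have w: "w \<in> carrier_vec (Suc n)" "w \<noteq> 0\<^sub>v (Suc n)" by (auto simp: w_def)
      have cb: "cnj b = (\<Sum>i<n. x (Suc i) 0 * cnj (v $ i))"
        using cnjX by (simp add: b_def x_def)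
      have "(X *\<^sub>v w) \<bullet>c w = (\<Sum>i<Suc n. \<Sum>j<Suc n. x i j * w $ j * cnj (w $ i))"
        using quadratic_form_sum[OF Xc w(1)] by (simp add: x_def)
      also have "\<dots> = (a * w0 + b) * cnj w0
          + (\<Sum>i<n. x (Suc i) 0 * w0 * cnj (v $ i) + (\<Sum>j<n. x (Suc i) (Suc j) * v $ j * cnj (v $ i)))"
        by (simp del: sum.lessThan_Suc
            add: sum.lessThan_Suc_shift w_def b_def a sum_distrib_right distrib_right)
      also have "\<dots> = (a * w0 + b) * cnj w0 + w0 * cnj b
          + (\<Sum>i<n. \<Sum>j<n. x (Suc i) (Suc j) * v $ j * cnj (v $ i))"
        by (simp add: sum.distrib cb sum_distrib_left mult_ac)
      also have "\<dots> = (\<Sum>i<n. \<Sum>j<n. x (Suc i) (Suc j) * v $ j * cnj (v $ i)) - cnj b * b / a"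
        using a by (simp add: w0_def field_simps)
      also have "\<dots> = (C *\<^sub>v v) \<bullet>c v"
      proof -
        have "(C *\<^sub>v v) \<bullet>c v = (\<Sum>i<n. \<Sum>j<n. x (Suc i) (Suc j) * v $ j * cnj (v $ i)
            - (x (Suc i) 0 * cnj (v $ i)) * (x 0 (Suc j) * v $ j) / a)"
          unfolding quadratic_form_sum[OF C v(1)]
          by (intro sum.cong refl) (simp add: C_def algebra_simps)
        then show ?thesis
          unfolding cb unfolding b_def by (simp add: sum_subtractf sum_product sum_divide_distrib)
      qed
      finally show ?thesis using Xp[OF w] by simp
    qed
    ultimately show ?thesis using C by (auto simp: pos_def_mats_def)
  qed
  from Suc.IH[OF this] obtain R p where R: "R \<in> unit_upper n" and p: "\<And>i. 0 < p i"
    and CR: "C = mat_adjoint R * real_diag n p * R" by blast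
  have Rc: "R \<in> carrier_mat n n" using R by (auto simp: unit_upper_def)
  \<comment> \<open>The factor gets the first row of \<open>X\<close>, divided by the pivot
    \<open>a\<close>, on top of the factor \<open>R\<close> of \<open>C\<close>; correspondingly
    \<open>case_nat a p\<close> puts \<open>a\<close> in front of the pivots
    \<open>p\<close>.\<close>
  define R1 where "R1 = mat (Suc n) (Suc n) (\<lambda>(i, j). case i of
      0 \<Rightarrow> (case j of 0 \<Rightarrow> 1 | Suc j \<Rightarrow> x 0 (Suc j) / a)
    | Suc i \<Rightarrow> (case j of 0 \<Rightarrow> 0 | Suc j \<Rightarrow> R $$ (i, j)))"
  have R1c: "R1 \<in> carrier_mat (Suc n) (Suc n)" by (simp add: R1_def)
  have "upper_triangular R1"
    using R Rc by (intro upper_triangularI)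
      (auto simp: unit_upper_def R1_def upper_triangularD split: nat.splits)
  then have "R1 \<in> unit_upper (Suc n)"
    using R by (auto simp: unit_upper_def R1_def split: nat.splits)
  moreover have "0 < case_nat a p i" for i using a p by (cases i) auto
  moreover have "X = mat_adjoint R1 * real_diag (Suc n) (case_nat a p) * R1"
  proof (rule eq_matI)
    fix i j
    assume "i < dim_row (mat_adjoint R1 * real_diag (Suc n) (case_nat a p) * R1)"
      and "j < dim_col (mat_adjoint R1 * real_diag (Suc n) (case_nat a p) * R1)"
    then have ij: "i < Suc n" "j < Suc n" using R1c by auto
    have CR': "x (Suc i) (Suc j) = x (Suc i) 0 * x 0 (Suc j) / a
        + (\<Sum>k<n. cnj (R $$ (k, i)) * complex_of_real (p k) * R $$ (k, j))"
      if "i < n" "j < n" for i j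
      using arg_cong[OF CR, of "\<lambda>M. M $$ (i, j)"] that congruence_real_diag_index[OF Rc that]
      by (simp add: C_def algebra_simps)
    have x0: "cnj (x 0 i) = x i 0" if "i < Suc n" for i using cnjX that by (simp add: x_def)
    show "X $$ (i, j) = (mat_adjoint R1 * real_diag (Suc n) (case_nat a p) * R1) $$ (i, j)"
      unfolding congruence_real_diag_index[OF R1c ij] x_def[symmetric]
      using ij a x0 CR' by (cases i; cases j)
        (auto simp del: sum.lessThan_Suc simp: sum.lessThan_Suc_shift R1_def)
  qed (use R1c Xc in auto)
  ultimately show ?case by blast
qed

section \<open>Unitary matrices and the comparison of pivots\<close>

lemma unitary_adjoint:
  assumes "U \<in> unitary_mats n"
  shows "U \<in> carrier_mat n n" "mat_adjoint U \<in> carrier_mat n n"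
    "U * mat_adjoint U = 1\<^sub>m n" "mat_adjoint U * U = 1\<^sub>m n" "mat_adjoint U \<in> unitary_mats n"
  using assms by (auto simp: unitary_mats_def mat_adjoint_carrier)

lemma mult_carrier_square [simp]:
  "A \<in> carrier_mat n n \<Longrightarrow> B \<in> carrier_mat n n \<Longrightarrow> A * B \<in> carrier_mat n n"
  by (rule mult_carrier_mat)

text \<open>Needed for rewriting right-associated products, where an inverse pair occurs as
  \<open>A * (B * C)\<close> and the equation \<open>A * B = 1\<close> alone does not match.\<close>

lemma mult_cancel_inverse_left:
  fixes A B C :: "'a :: comm_ring_1 mat"
  assumes "A * B = 1\<^sub>m n" "A \<in> carrier_mat n n" "B \<in> carrier_mat n n" "C \<in> carrier_mat n n"
  shows "A * (B * C) = C"
  using assms by (simp add: assoc_mult_mat[of A n n B n C n, symmetric])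

lemma quadratic_form_diag_congruence:
  assumes "R \<in> carrier_mat n n" "v \<in> carrier_vec n"
  shows "((mat_adjoint R * real_diag n p * R) *\<^sub>v v) \<bullet>c v
    = complex_of_real (\<Sum>i<n. p i * (cmod ((R *\<^sub>v v) $ i))\<^sup>2)"
  using assms
  by (simp add: quadratic_form_congruence[of _ n] quadratic_form_real_diag mult_mat_vec_carrier[of R n n]
      del: index_mult_mat_vec)

text \<open>The \<open>i\<close>-th pivot is the minimum of the quadratic form over the vectors \<open>x\<close> with \<open>x i = 1\<close> and
  \<open>x j = 0\<close> for \<open>j > i\<close>.\<close>

lemma cholesky_pivot_mono:
  assumes R: "R \<in> unit_upper n" and S: "S \<in> unit_upper n" and p: "\<And>i. 0 < p i"
    and le: "\<And>v. v \<in> carrier_vec n \<Longrightarrow>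
      ((mat_adjoint R * real_diag n p * R) *\<^sub>v v) \<bullet>c v
      \<le> ((mat_adjoint S * real_diag n r * S) *\<^sub>v v) \<bullet>c v"
    and i: "i < n"
  shows "p i \<le> r i"
proof -
  obtain T where T: "T \<in> unit_upper n" "S * T = 1\<^sub>m n" "T * S = 1\<^sub>m n"
    using unit_upper_inverse[OF S] .
  have c: "R \<in> carrier_mat n n" "S \<in> carrier_mat n n" "T \<in> carrier_mat n n"
    using R S T by (auto simp: unit_upper_def)
  \<comment> \<open>With \<open>T\<close> the inverse of \<open>S\<close>, this vector satisfies
    \<open>S x = e_i\<close>, so the right-hand form there is \<open>r i\<close>. Since
    \<open>R * T\<close> has unit diagonal, \<open>R x\<close> has \<open>i\<close>-th coordinate 1,
    and the left-hand form is at least \<open>p i\<close>.\<close>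
  define x where "x = col T i"
  have x: "x \<in> carrier_vec n" using c by (auto simp: x_def intro!: carrier_vecI)
  have Sx: "S *\<^sub>v x = unit_vec n i"
    using col_mult2[OF c(2,3) i] T(2) i by (simp add: x_def)
  have "R *\<^sub>v x = col (R * T) i"
    using col_mult2[OF c(1,3) i] by (simp add: x_def)
  moreover have "(R * T) $$ (i, i) = 1"
    using upper_triangular_mult(2)[of R n T i] R T i by (auto simp: unit_upper_def)
  moreover have "col (R * T) i $ i = (R * T) $$ (i, i)"
    using c i by (intro index_col) auto
  ultimately have Rx: "(R *\<^sub>v x) $ i = 1" by simp
  have "p i = p i * (cmod ((R *\<^sub>v x) $ i))\<^sup>2" by (simp add: Rx del: index_mult_mat_vec)
  also have "\<dots> \<le> (\<Sum>k<n. p k * (cmod ((R *\<^sub>v x) $ k))\<^sup>2)"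
    by (rule member_le_sum) (use i p in \<open>auto simp: less_imp_le\<close>)
  also have "\<dots> \<le> (\<Sum>k<n. r k * (cmod ((S *\<^sub>v x) $ k))\<^sup>2)"
    using le[OF x] c x by (simp add: quadratic_form_diag_congruence less_eq_complex_def)
  also have "\<dots> = (\<Sum>k<n. if k = i then r i else 0)"
    unfolding Sx using i by (intro sum.cong) auto
  also have "\<dots> = r i" using i by simp
  finally show ?thesis .
qed

lemma real_diag_const_commute:
  assumes "M \<in> carrier_mat n n"
  shows "real_diag n (\<lambda>_. c) * M = M * real_diag n (\<lambda>_. c)"
  using assms by (auto simp: real_diag_def mat_diag_mult_left mat_diag_mult_right mult.commute)

text \<open>Entry \<open>(i, j)\<close> is scaled by \<open>g j / g i\<close>, which keeps the zeros
  below the diagonal and the ones on it. This turns a Cholesky factor of \<open>H\<close> into one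
  of \<open>diag g * H * diag g\<close>.\<close>

lemma diag_conjugate_unit_upper:
  assumes R: "R \<in> unit_upper n" and g: "\<And>i. g i \<noteq> 0"
  shows "real_diag n (\<lambda>i. 1 / g i) * R * real_diag n g \<in> unit_upper n"
    (is "?M \<in> _")
proof -
  have Rc: "R \<in> carrier_mat n n" using R by (simp add: unit_upper_def)
  have "?M $$ (i, j) = complex_of_real (1 / g i) * R $$ (i, j) * complex_of_real (g j)"
    if "i < n" "j < n" for i j
    using that Rc
    by (simp add: real_diag_def mat_diag_mult_left mat_diag_mult_right[of _ n n])
  note ix = this
  have "upper_triangular ?M"
    using R Rc by (intro upper_triangularI)
      (auto simp: ix unit_upper_def upper_triangularD simp del: index_mult_mat(1))
  then show ?thesis using R g
    by (auto simp: ix unit_upper_def simp del: index_mult_mat(1))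
qed

section \<open>Log-majorisation\<close>

text \<open>The product equality is the comparison of determinants in \<open>eq\<close>. For the
  inequality, the pivots of one clipped form are bounded below in two ways, and the larger bound is
  used separately at each index.\<close>

lemma clipped_product_le:
  assumes K: "K \<in> carrier_mat n n" and dK: "det K \<noteq> 0"
    and W: "W \<in> unitary_mats n"
    and s: "\<And>i. 0 < s i" and g: "\<And>i. 0 < g i"
    and eq: "mat_adjoint K * (W * real_diag n s * mat_adjoint W) * K
           = real_diag n g * (mat_adjoint K * K) * real_diag n g"
  shows "0 < c \<Longrightarrow> (\<Prod>i<n. max ((g i)\<^sup>2) c) \<le> (\<Prod>i<n. max (s i) c)"
    and "(\<Prod>i<n. (g i)\<^sup>2) = (\<Prod>i<n. s i)"
proof -
  note as = assoc_mult_mat[of _ n n _ n _ n]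
  note Wc = unitary_adjoint[OF W]
  have K': "mat_adjoint K \<in> carrier_mat n n" using K by (simp add: mat_adjoint_carrier)
  obtain L where L: "L \<in> carrier_mat n n" "K * L = 1\<^sub>m n" "L * K = 1\<^sub>m n"
    using det_nonzero_inverse[OF K dK] .
  define D where "D = det (mat_adjoint K) * det K"
  have dW: "det W * det (mat_adjoint W) = 1"
    using det_mult[OF Wc(1,2)] Wc by simp
  have dW': "det W * (x * det (mat_adjoint W)) = x" for x
    using dW by (simp add: mult.left_commute)
  \<comment> \<open>The spectrum \<open>t\<close> is left free: it will be \<open>s\<close>, a
    constant, and the clipped spectrum \<open>m\<close>. The factor \<open>D\<close> is common to
    all of them and cancels in the end.\<close>
  have det_form: "det (mat_adjoint K * (W * real_diag n t * mat_adjoint W) * K)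
      = D * complex_of_real (\<Prod>i<n. t i)" for t
    using K K' Wc(1,2) by (simp add: det_mult[of _ n] real_diag_det D_def dW dW' del: of_real_prod)
  have pd: "mat_adjoint K * (W * real_diag n t * mat_adjoint W) * K \<in> pos_def_mats n"
    if t: "\<And>i. 0 < t i" for t
    using pos_def_congruence[OF pos_def_congruence[OF real_diag_pos_def[OF t] Wc(2,1,3)] K L(1,3)]
    by simp
  have form: "((mat_adjoint K * (W * real_diag n t * mat_adjoint W) * K) *\<^sub>v v) \<bullet>c v
      = complex_of_real (\<Sum>i<n. t i * (cmod ((mat_adjoint W *\<^sub>v (K *\<^sub>v v)) $ i))\<^sup>2)"
    if v: "v \<in> carrier_vec n" for t v
    using quadratic_form_diag_congruence[OF Wc(2), of "K *\<^sub>v v" t]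
      quadratic_form_congruence[of "W * real_diag n t * mat_adjoint W" n K n v] K v Wc(1,2)
    by (simp del: index_mult_mat_vec)
  have const: "mat_adjoint K * (W * real_diag n (\<lambda>_. c) * mat_adjoint W) * K
      = mat_adjoint K * K * real_diag n (\<lambda>_. c)" for c
    using K K' Wc(1,2)
    by (simp add: as real_diag_const_commute mult_cancel_inverse_left[OF Wc(3)])
  have one: "mat_adjoint K * (W * real_diag n (\<lambda>_. 1) * mat_adjoint W) * K = mat_adjoint K * K"
    using const[of 1] K K' by (simp add: real_diag_one)
  obtain R h where R: "R \<in> unit_upper n" and h: "\<And>i. 0 < h i"
    and H: "mat_adjoint K * K = mat_adjoint R * real_diag n h * R"
    using cholesky[OF pd[of "\<lambda>_. 1"]] one by auto
  have Rc: "R \<in> carrier_mat n n" "mat_adjoint R \<in> carrier_mat n n"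
    using R by (auto simp: unit_upper_def mat_adjoint_carrier)
  have det_chol: "det (mat_adjoint S * real_diag n t * S) = complex_of_real (\<Prod>i<n. t i)"
    if "S \<in> unit_upper n" for S t
  proof -
    have "S \<in> carrier_mat n n" "mat_adjoint S \<in> carrier_mat n n"
      using that by (auto simp: unit_upper_def mat_adjoint_carrier)
    then show ?thesis
      using unit_upper_det[OF that]
      by (simp add: det_mult[of _ n] real_diag_det mat_adjoint_det[of S n] del: of_real_prod)
  qed
  have D: "D = complex_of_real (\<Prod>i<n. h i)"
    using det_form[of "\<lambda>_. 1"] det_chol[OF R, of h] H by (simp add: one)
  have hpos: "0 < (\<Prod>i<n. h i)" using h by (intro prod_pos) auto
  \<comment> \<open>Chosen so that \<open>diag g * R2 = R * diag g\<close>; hence \<open>R2\<close>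
    is the Cholesky factor of the right-hand side of \<open>eq\<close>, with pivots
    \<open>(g i)^2 * h i\<close>.\<close>
  define R2 where "R2 = real_diag n (\<lambda>i. 1 / g i) * R * real_diag n g"
  have gn0: "g i \<noteq> 0" for i using g[of i] by simp
  have R2: "R2 \<in> unit_upper n"
    unfolding R2_def by (rule diag_conjugate_unit_upper[OF R gn0])
  have R2c: "R2 \<in> carrier_mat n n" "mat_adjoint R2 \<in> carrier_mat n n"
    using R2 by (auto simp: unit_upper_def mat_adjoint_carrier)
  have gR2: "real_diag n g * R2 = R * real_diag n g"
  proof -
    have "real_diag n g * R2 = real_diag n g * real_diag n (\<lambda>i. 1 / g i) * (R * real_diag n g)"
      unfolding R2_def using Rc by (simp add: as)
    then show ?thesis using Rc gn0 by (simp add: real_diag_mult real_diag_one)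
  qed
  have gHg: "real_diag n g * (mat_adjoint K * K) * real_diag n g
      = mat_adjoint R2 * real_diag n (\<lambda>i. (g i)\<^sup>2 * h i) * R2"
  proof -
    have "mat_adjoint R2 * real_diag n g = mat_adjoint (real_diag n g * R2)"
      using R2c by (simp add: mat_adjoint_mult[of _ n n _ n])
    also have "\<dots> = real_diag n g * mat_adjoint R"
      unfolding gR2 using Rc by (simp add: mat_adjoint_mult[of _ n n _ n])
    finally have gR2': "mat_adjoint R2 * real_diag n g = real_diag n g * mat_adjoint R" .
    have "real_diag n g * (mat_adjoint K * K) * real_diag n g
        = (real_diag n g * mat_adjoint R) * real_diag n h * (R * real_diag n g)"
      unfolding H using Rc by (simp add: as)
    also have "\<dots> = mat_adjoint R2 * (real_diag n g * real_diag n h * real_diag n g) * R2"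
      unfolding gR2'[symmetric] gR2[symmetric] using R2c by (simp add: as)
    finally show ?thesis
      by (simp add: real_diag_mult power2_eq_square mult_ac)
  qed
  have "D * complex_of_real (\<Prod>i<n. s i) = complex_of_real (\<Prod>i<n. (g i)\<^sup>2 * h i)"
    using det_form[of s] det_chol[OF R2, of "\<lambda>i. (g i)\<^sup>2 * h i"] by (simp add: eq gHg)
  then have "(\<Prod>i<n. h i) * (\<Prod>i<n. s i) = (\<Prod>i<n. (g i)\<^sup>2) * (\<Prod>i<n. h i)"
    unfolding D of_real_mult[symmetric] of_real_eq_iff by (simp add: prod.distrib)
  then show "(\<Prod>i<n. (g i)\<^sup>2) = (\<Prod>i<n. s i)" using h by (auto simp: less_le)
  assume c: "0 < c"
  define m where "m i = max (s i) c" for i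
  have m: "0 < m i" "s i \<le> m i" "c \<le> m i" for i using c by (auto simp: m_def)
  define Z where "Z = mat_adjoint K * (W * real_diag n m * mat_adjoint W) * K"
  obtain S z where S: "S \<in> unit_upper n" and z: "\<And>i. 0 < z i"
    and Z: "Z = mat_adjoint S * real_diag n z * S"
    using cholesky[OF pd[of m, OF m(1)]] by (auto simp: Z_def)
  \<comment> \<open>Both \<open>s\<close> and the constant \<open>c\<close> lie below
    \<open>m\<close>, so the form in \<open>eq\<close> and \<open>c\<close> times the Gram form both
    lie below that of \<open>Z\<close>.\<close>
  have form_mono: "((mat_adjoint K * (W * real_diag n t * mat_adjoint W) * K) *\<^sub>v v) \<bullet>c v
      \<le> (Z *\<^sub>v v) \<bullet>c v"
    if "\<And>i. t i \<le> m i" "v \<in> carrier_vec n" for t v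
    using that unfolding Z_def
    by (auto simp: form less_eq_complex_def simp del: index_mult_mat_vec of_real_sum
        intro!: sum_mono mult_right_mono)
  have "(g i)\<^sup>2 * h i \<le> z i" if "i < n" for i
  proof (rule cholesky_pivot_mono[OF R2 S _ _ that])
    show "0 < (g i)\<^sup>2 * h i" for i using g[of i] h[of i] by simp
    show "((mat_adjoint R2 * real_diag n (\<lambda>i. (g i)\<^sup>2 * h i) * R2) *\<^sub>v v) \<bullet>c v
        \<le> ((mat_adjoint S * real_diag n z * S) *\<^sub>v v) \<bullet>c v" if "v \<in> carrier_vec n" for v
      using form_mono[of s v] m that by (simp add: eq gHg Z)
  qed
  moreover have "c * h i \<le> z i" if "i < n" for i
  proof (rule cholesky_pivot_mono[OF R S _ _ that])
    show "0 < c * h i" for i using c h[of i] by simp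
    have "mat_adjoint R * real_diag n (\<lambda>i. c * h i) * R
        = mat_adjoint K * K * real_diag n (\<lambda>_. c)"
      unfolding H using Rc 
      by (simp add: as real_diag_const_commute[symmetric] real_diag_mult[symmetric])
        (simp add: as[symmetric] real_diag_const_commute[OF Rc(2)])
    then show "((mat_adjoint R * real_diag n (\<lambda>i. c * h i) * R) *\<^sub>v v) \<bullet>c v
        \<le> ((mat_adjoint S * real_diag n z * S) *\<^sub>v v) \<bullet>c v" if "v \<in> carrier_vec n" for v
      using form_mono[of "\<lambda>_. c" v] m that by (simp add: const Z)
  qed
  ultimately have "max ((g i)\<^sup>2) c * h i \<le> z i" if "i < n" for i
    using that by (cases "(g i)\<^sup>2 \<le> c") (auto simp: max_def)
  then have "(\<Prod>i<n. max ((g i)\<^sup>2) c * h i) \<le> (\<Prod>i<n. z i)"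
    using h c by (intro prod_mono) (auto simp: less_imp_le le_max_iff_disj)
  \<comment> \<open>The determinant of \<open>Z\<close>, computed from its pivots and from the
    clipped spectrum; the positive product of the \<open>h i\<close> then cancels from both
    sides.\<close>
  also have "(\<Prod>i<n. z i) = (\<Prod>i<n. h i) * (\<Prod>i<n. m i)"
    using det_form[of m] det_chol[OF S, of z] Z
    unfolding Z_def[symmetric] D of_real_mult[symmetric] by (simp del: of_real_prod of_real_mult)
  finally show "(\<Prod>i<n. max ((g i)\<^sup>2) c) \<le> (\<Prod>i<n. max (s i) c)"
    using hpos by (simp add: prod.distrib m_def)
qed

section \<open>Spectral theorem\<close>

text \<open>With \<open>A = P B P\<^sup>-\<^sup>1\<close> a Schur triangularisation and \<open>P\<^sup>* P = R\<^sup>* diag p R\<close> a Cholesky factorisation,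
  the unitary matrix is \<open>P R\<^sup>-\<^sup>1 diag (1 / sqrt p)\<close>: it conjugates \<open>A\<close> to a matrix that is
  both Hermitian and triangular.\<close>

lemma hermitian_diagonalization:
  assumes A: "A \<in> carrier_mat n n" and herm: "mat_adjoint A = A"
  obtains U d where "U \<in> unitary_mats n" "A = U * real_diag n d * mat_adjoint U"
proof -
  note as = assoc_mult_mat[of _ n n _ n _ n]
  obtain es where "char_poly A = (\<Prod>e\<leftarrow>es. [:- e, 1:])"
    using char_poly_factorized[OF A] by auto
  then obtain B P Q where "similar_mat_wit A B P Q" and Bt: "upper_triangular B"
    using schur_decomposition[OF A] by (metis prod_cases3)
  then have c: "B \<in> carrier_mat n n" "P \<in> carrier_mat n n" "Q \<in> carrier_mat n n"
    and PQ: "P * Q = 1\<^sub>m n" "Q * P = 1\<^sub>m n" and APQ: "A = P * B * Q"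
    using A by (auto simp: similar_mat_wit_def Let_def)
  have c': "mat_adjoint P \<in> carrier_mat n n" using c by (simp add: mat_adjoint_carrier)
  \<comment> \<open>The identity is written as a constant diagonal matrix, so that the Gram matrix
    of \<open>P\<close> is a congruence of a positive definite one.\<close>
  have "mat_adjoint P * real_diag n (\<lambda>_. 1) * P \<in> pos_def_mats n"
    using c PQ by (intro pos_def_congruence[of _ n P Q] real_diag_pos_def) auto
  moreover have "mat_adjoint P * real_diag n (\<lambda>_. 1) * P = mat_adjoint P * P"
    by (simp add: real_diag_one right_mult_one_mat[OF c'])
  ultimately obtain R p where R: "R \<in> unit_upper n" and p: "\<And>i. 0 < p i"
    and PP: "mat_adjoint P * P = mat_adjoint R * real_diag n p * R"
    using cholesky by metis
  obtain T where T: "T \<in> unit_upper n" "R * T = 1\<^sub>m n" "T * R = 1\<^sub>m n"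
    using unit_upper_inverse[OF R] .
  have RT: "R \<in> carrier_mat n n" "T \<in> carrier_mat n n" "upper_triangular R" "upper_triangular T"
    "mat_adjoint R \<in> carrier_mat n n" "mat_adjoint T \<in> carrier_mat n n"
    using R T by (auto simp: unit_upper_def mat_adjoint_carrier)
  have TR': "mat_adjoint T * mat_adjoint R = 1\<^sub>m n"
    using mat_adjoint_mult[OF RT(1,2)] T by simp
  define q where "q = real_diag n (\<lambda>i. sqrt (p i))"
  define q' where "q' = real_diag n (\<lambda>i. 1 / sqrt (p i))"
  have q: "q \<in> carrier_mat n n" "q' \<in> carrier_mat n n" "mat_adjoint q' = q'"
    by (auto simp: q_def q'_def)
  have qt: "upper_triangular q" "upper_triangular q'"
    by (auto simp: q_def q'_def real_diag_index)
  have p0: "sqrt (p i) \<noteq> 0" "sqrt (p i) * sqrt (p i) = p i" for i using p[of i] by auto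
  have qq: "q' * q = 1\<^sub>m n" "q * q' = 1\<^sub>m n" 
    using p0 by (auto simp: q_def q'_def real_diag_mult intro!: real_diag_one)
  have pq: "real_diag n p = q * q" using p0 by (simp add: q_def real_diag_mult)
  define U where "U = P * T * q'"
  have U: "U \<in> carrier_mat n n" "mat_adjoint U \<in> carrier_mat n n"
    using c RT q by (auto simp: U_def mat_adjoint_carrier)
  have U': "mat_adjoint U = q' * mat_adjoint T * mat_adjoint P"
    using c c' RT q by (simp add: U_def mat_adjoint_mult[of _ n n _ n] as)
  \<comment> \<open>The adjoint of \<open>U\<close> cancels the left half of the Gram matrix
    \<open>mat_adjoint R * q * q * R\<close>.\<close>
  have UP: "mat_adjoint U * P = q * R"
  proof -
    have "mat_adjoint U * P = q' * (mat_adjoint T * (mat_adjoint R * (q * (q * R))))"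
      using c c' RT q by (simp add: U' as PP pq)
    also have "\<dots> = q * R"
      using q RT by (simp add: mult_cancel_inverse_left[OF TR'] mult_cancel_inverse_left[OF qq(1)])
    finally show ?thesis .
  qed
  have UU: "mat_adjoint U * U = 1\<^sub>m n"
  proof -
    have "mat_adjoint U * U = mat_adjoint U * P * (T * q')"
      using U c RT q by (simp add: U_def as)
    also have "\<dots> = q * (R * (T * q'))"
      unfolding UP using RT q by (simp add: as)
    finally show ?thesis
      using q RT by (simp add: mult_cancel_inverse_left[OF T(2)] qq)
  qed
  have UU': "U * mat_adjoint U = 1\<^sub>m n"
    using mat_mult_left_right_inverse[OF U(2,1) UU] .
  have Uu: "U \<in> unitary_mats n" using U UU UU' by (simp add: unitary_mats_def)
  define M where "M = mat_adjoint U * A * U"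
  have Mc: "M \<in> carrier_mat n n" using U A by (simp add: M_def)
  have Mh: "mat_adjoint M = M"
    using U A by (simp add: M_def mat_adjoint_mult[of _ n n _ n] herm as)
  have AM: "A = U * M * mat_adjoint U"
    using U A by (simp add: M_def as mult_cancel_inverse_left[OF UU'] UU')
  \<comment> \<open>Since \<open>Q\<close> is inverse to \<open>P\<close>, the right factor
    \<open>Q * U\<close> is \<open>T * q'\<close>; all the factors are now upper triangular.\<close>
  have "M = q * R * B * (T * q')"
  proof -
    have "M = mat_adjoint U * (P * B * Q) * (P * T * q')"
      unfolding M_def APQ[symmetric] U_def[symmetric] ..
    also have "\<dots> = mat_adjoint U * P * B * (Q * P * (T * q'))"
      using U c RT q by (simp add: as)
    finally have "M = mat_adjoint U * P * B * (Q * P * (T * q'))" .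
    then show ?thesis using c RT q by (simp add: UP PQ)
  qed
  moreover have "upper_triangular (q * R * B * (T * q'))"
    using Bt c RT q qt by (simp add: upper_triangular_mult(1)[of _ n])
  ultimately have Mt: "upper_triangular M" by simp
  have "M = real_diag n (\<lambda>i. Re (M $$ (i, i)))"
  proof (rule eq_matI)
    fix i j assume "i < dim_row (real_diag n (\<lambda>i. Re (M $$ (i, i))))"
      "j < dim_col (real_diag n (\<lambda>i. Re (M $$ (i, i))))"
    then have ij: "i < n" "j < n" by auto
    have cnjM: "cnj (M $$ (j, i)) = M $$ (i, j)"
      using mat_adjoint_index[of i M j] Mh Mc ij by simp
    consider "i = j" | "i < j" | "j < i" by linarith
    then show "M $$ (i, j) = real_diag n (\<lambda>i. Re (M $$ (i, i))) $$ (i, j)"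
    proof cases
      case 1
      then have "Im (M $$ (i, i)) = 0" using cnjM by (metis complex_cnj_cancel_iff cnj.simps(2) neg_equal_zero)
      then show ?thesis using 1 ij by (simp add: real_diag_index complex_eq_iff)
    next
      case 2
      then have "M $$ (j, i) = 0" using upper_triangularD[OF Mt] ij Mc by auto
      then show ?thesis using 2 cnjM ij by (simp add: real_diag_index)
    next
      case 3
      then show ?thesis using upper_triangularD[OF Mt] ij Mc by (simp add: real_diag_index)
    qed
  qed (use Mc in auto)
  then show ?thesis using that[OF Uu, of "\<lambda>i. Re (M $$ (i, i))"] AM by simp
qed

lemma pos_def_diagonalization:
  assumes A: "A \<in> pos_def_mats n"
  obtains U d where "U \<in> unitary_mats n" "\<And>i. 0 < d i" "A = U * real_diag n d * mat_adjoint U"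
proof -
  have Ac: "A \<in> carrier_mat n n" "mat_adjoint A = A" using A by (auto simp: pos_def_mats_def)
  obtain U d where U: "U \<in> unitary_mats n" and AU: "A = U * real_diag n d * mat_adjoint U"
    using hermitian_diagonalization[OF Ac] .
  note Uc = unitary_adjoint[OF U]
  have "mat_adjoint U * A * U = real_diag n d"
    unfolding AU using Uc
    by (simp add: assoc_mult_mat[of _ n n _ n _ n] mult_cancel_inverse_left[OF Uc(4)])
  with pos_def_congruence[OF A Uc(1,2,4)] have pd: "real_diag n d \<in> pos_def_mats n" by simp
  have pos: "0 < d i" if i: "i < n" for i
  proof -
    have "0 < (real_diag n d *\<^sub>v unit_vec n i) \<bullet>c unit_vec n i"
      using pd i by (auto simp: pos_def_mats_def simp del: index_mult_mat_vec)
    also have "\<dots> = complex_of_real (\<Sum>k<n. if k = i then d i else 0)"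
      unfolding quadratic_form_real_diag[OF unit_vec_carrier] of_real_eq_iff
      by (rule sum.cong) (use i in auto)
    finally show ?thesis using i by (simp add: less_complex_def)
  qed
  \<comment> \<open>Values of \<open>d\<close> from index \<open>n\<close> on do not enter the
    matrix; setting them to 1 gives positivity at every index.\<close>
  have "real_diag n d = real_diag n (\<lambda>i. if i < n then d i else 1)"
    by (rule eq_matI) (auto simp: real_diag_index)
  then show ?thesis
    using that[OF U, of "\<lambda>i. if i < n then d i else 1"] pos AU by auto
qed

section \<open>Frobenius norms and sums of squares\<close>

lemma trace_mult_commute:
  fixes A B :: "complex mat"
  assumes "A \<in> carrier_mat n n" "B \<in> carrier_mat n n"
  shows "(\<Sum>i<n. (A * B) $$ (i, i)) = (\<Sum>i<n. (B * A) $$ (i, i))"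
proof -
  have "(\<Sum>i<n. (A * B) $$ (i, i)) = (\<Sum>i<n. \<Sum>j<n. A $$ (i, j) * B $$ (j, i))"
    using assms by (simp add: mult_mat_index_sum[of _ n n _ n] del: index_mult_mat(1))
  also have "\<dots> = (\<Sum>j<n. \<Sum>i<n. A $$ (i, j) * B $$ (j, i))" by (rule sum.swap)
  also have "\<dots> = (\<Sum>i<n. (B * A) $$ (i, i))"
    using assms by (simp add: mult_mat_index_sum[of _ n n _ n] mult.commute del: index_mult_mat(1))
  finally show ?thesis .
qed

text \<open>The squared norm is the trace of \<open>X * mat_adjoint X\<close>, and cyclicity of the
  trace removes the unitary factors.\<close>

lemma frobenius_norm_unitary_diag:
  assumes U: "U \<in> unitary_mats n"
  shows "frobenius_norm (U * real_diag n d * mat_adjoint U) = sqrt (\<Sum>i<n. (d i)\<^sup>2)"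
proof -
  note as = assoc_mult_mat[of _ n n _ n _ n]
  note Uc = unitary_adjoint[OF U]
  define X where "X = U * real_diag n d * mat_adjoint U"
  have X: "X \<in> carrier_mat n n" "mat_adjoint X \<in> carrier_mat n n"
    using Uc by (auto simp: X_def mat_adjoint_carrier)
  have "mat_adjoint X = X"
    using Uc by (simp add: X_def mat_adjoint_mult[of _ n n _ n] as)
  then have XX: "X * mat_adjoint X = U * (real_diag n (\<lambda>i. (d i)\<^sup>2) * mat_adjoint U)"
    using Uc by (simp add: X_def as mult_cancel_inverse_left[OF Uc(4)] power2_eq_square
        real_diag_mult[symmetric])
  have "complex_of_real (\<Sum>i<n. \<Sum>j<n. (cmod (X $$ (i, j)))\<^sup>2)
      = (\<Sum>i<n. (X * mat_adjoint X) $$ (i, i))"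
    unfolding of_real_sum complex_norm_square
    using X by (simp add: mult_mat_index_sum[of _ n n _ n] del: index_mult_mat(1))
  also have "\<dots> = (\<Sum>i<n. (real_diag n (\<lambda>i. (d i)\<^sup>2)) $$ (i, i))"
    unfolding XX using Uc by (subst trace_mult_commute[of _ n]) (simp_all add: as)
  also have "\<dots> = complex_of_real (\<Sum>i<n. (d i)\<^sup>2)"
    by (simp add: real_diag_index)
  finally have "(\<Sum>i<n. \<Sum>j<n. (cmod (X $$ (i, j)))\<^sup>2) = (\<Sum>i<n. (d i)\<^sup>2)"
    by (simp only: of_real_eq_iff)
  then show ?thesis using X by (simp add: frobenius_norm_def X_def[symmetric])
qed

text \<open>The kink of the hinge at 0 disappears on squaring: at every \<open>u\<close> the
  difference quotient is within \<open>\<bar>h\<bar>\<close> of the claimed derivative.\<close>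

lemma max_zero_square_deriv: "DERIV (\<lambda>u::real. (max u 0)\<^sup>2) u :> 2 * max u 0"
proof -
  have bound: "\<bar>((max (u + h) 0)\<^sup>2 - (max u 0)\<^sup>2) / h - 2 * max u 0\<bar> \<le> \<bar>h\<bar>" if "h \<noteq> 0" for h
  proof -
    have "\<bar>(max (u + h) 0)\<^sup>2 - (max u 0)\<^sup>2 - 2 * max u 0 * h\<bar> \<le> h\<^sup>2"
    proof -
      have sq: "(u + h)\<^sup>2 = u\<^sup>2 + 2 * u * h + h\<^sup>2" by (simp add: power2_eq_square algebra_simps)
      consider "0 \<le> u" "0 \<le> u + h" | "0 \<le> u" "u + h < 0" | "u < 0" "0 \<le> u + h" | "u < 0" "u + h < 0"
        by linarith
      then show ?thesis
      proof cases
        case 1 then show ?thesis by (simp add: sq)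
      next
        case 2
        \<comment> \<open>Here the error is \<open>- u^2 - 2 * u * h\<close>. It is bounded below
          through \<open>u \<le> - h\<close> and above through
          \<open>(u + h)^2 \<ge> 0\<close>.\<close>
        then have "u * u \<le> u * (- h)" by (intro mult_left_mono) auto
        moreover have "u * (- 2 * h) - u * u \<le> h * h"
          using zero_le_square[of "u + h"] by (simp add: algebra_simps)
        ultimately show ?thesis using 2 mult_nonneg_nonneg[of u "- h"]
          by (simp add: max_def power2_eq_square abs_le_iff algebra_simps)
      next
        case 3
        then have "(u + h)\<^sup>2 \<le> h\<^sup>2" by (intro power_mono) auto
        then show ?thesis using 3 by simp
      next
        case 4 then show ?thesis by simp
      qed
    qed
    then have "\<bar>(max (u + h) 0)\<^sup>2 - (max u 0)\<^sup>2 - 2 * max u 0 * h\<bar> / \<bar>h\<bar> \<le> h\<^sup>2 / \<bar>h\<bar>"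
      by (intro divide_right_mono) auto
    moreover have "((max (u + h) 0)\<^sup>2 - (max u 0)\<^sup>2) / h - 2 * max u 0
        = ((max (u + h) 0)\<^sup>2 - (max u 0)\<^sup>2 - 2 * max u 0 * h) / h"
      using that by (simp add: field_simps)
    moreover have "h\<^sup>2 / \<bar>h\<bar> = \<bar>h\<bar>" using that by (simp add: power2_eq_square field_simps)
    ultimately show ?thesis by (simp add: abs_divide)
  qed
  have "((\<lambda>h. ((max (u + h) 0)\<^sup>2 - (max u 0)\<^sup>2) / h - 2 * max u 0) \<longlongrightarrow> 0) (at 0)"
    by (rule tendsto_0_le[of "\<lambda>h. h" _ _ 1])
      (auto simp: eventually_at_filter intro!: tendsto_ident_at always_eventually bound)
  then show ?thesis unfolding DERIV_def by (rule LIM_zero_cancel)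
qed

text \<open>The sum of squares is an integral of sums of hinges: \<open>-2 \<Sum>i max (y i - t) 0\<close> is the derivative
  of \<open>\<Sum>i (max (y i - t) 0)\<^sup>2\<close>, which is \<open>\<Sum>i (y i - t)\<^sup>2\<close> for very negative \<open>t\<close>.\<close>

lemma sum_squares_majorization:
  fixes x y :: "nat \<Rightarrow> real"
  assumes hinge: "\<And>t. (\<Sum>i<n. max (x i) t) \<le> (\<Sum>i<n. max (y i) t)"
    and total: "(\<Sum>i<n. x i) = (\<Sum>i<n. y i)"
  shows "(\<Sum>i<n. (x i)\<^sup>2) \<le> (\<Sum>i<n. (y i)\<^sup>2)"
proof -
  define F where "F t = (\<Sum>i<n. (max (y i - t) 0)\<^sup>2) - (\<Sum>i<n. (max (x i - t) 0)\<^sup>2)" for t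
  \<comment> \<open>A bound on all entries: at \<open>t = B\<close> every squared hinge vanishes,
    and at \<open>t = - B\<close> each equals \<open>(z i + B)^2\<close>.\<close>
  define B where "B = (\<Sum>i<n. \<bar>x i\<bar> + \<bar>y i\<bar>)"
  have B: "\<bar>x i\<bar> \<le> B" "\<bar>y i\<bar> \<le> B" if "i < n" for i
    using member_le_sum[of i "{..<n}" "\<lambda>i. \<bar>x i\<bar> + \<bar>y i\<bar>"] that by (auto simp: B_def)
  have B0: "- B \<le> B" by (simp add: B_def sum_nonneg)
  have deriv: "DERIV F t :> (\<Sum>i<n. - 2 * max (y i - t) 0) - (\<Sum>i<n. - 2 * max (x i - t) 0)" for t
  proof -
    have "DERIV (\<lambda>t. (max (c - t) 0)\<^sup>2) t :> - 2 * max (c - t) 0" for c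
    proof -
      have "DERIV (\<lambda>t. c - t) t :> - 1" by (auto intro!: derivative_eq_intros)
      from DERIV_chain'[OF this max_zero_square_deriv] show ?thesis by simp
    qed
    then show ?thesis unfolding F_def
      by (intro DERIV_diff DERIV_sum) auto
  qed
  have "F B \<le> F (- B)"
  proof (rule DERIV_nonpos_imp_nonincreasing[OF B0], intro exI conjI)
    fix t
    show "DERIV F t :> (\<Sum>i<n. - 2 * max (y i - t) 0) - (\<Sum>i<n. - 2 * max (x i - t) 0)"
      by (rule deriv)
    have m: "max (c - t) 0 = max c t - t" for c :: real by (auto simp: max_def)
    show "(\<Sum>i<n. - 2 * max (y i - t) 0) - (\<Sum>i<n. - 2 * max (x i - t) 0) \<le> 0"
      using hinge[of t] by (simp add: m sum_subtractf sum_negf sum_distrib_left[symmetric])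
  qed
  moreover have "F B = 0"
  proof -
    have "(\<Sum>i<n. (max (y i - B) 0)\<^sup>2) = 0" "(\<Sum>i<n. (max (x i - B) 0)\<^sup>2) = 0"
      using B by (auto intro!: sum.neutral simp: abs_le_iff)
    then show ?thesis by (simp add: F_def)
  qed
  moreover have "F (- B) = (\<Sum>i<n. (y i)\<^sup>2) - (\<Sum>i<n. (x i)\<^sup>2)"
  proof -
    \<comment> \<open>On subtracting the two expansions, the linear terms cancel by
      \<open>total\<close>, and the constant terms agree.\<close>
    have "(\<Sum>i<n. (max (z i - - B) 0)\<^sup>2) = (\<Sum>i<n. (z i)\<^sup>2) + 2 * B * (\<Sum>i<n. z i) + n * B\<^sup>2"
      if "\<And>i. i < n \<Longrightarrow> \<bar>z i\<bar> \<le> B" for z :: "nat \<Rightarrow> real"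
    proof -
      have "(\<Sum>i<n. (max (z i - - B) 0)\<^sup>2) = (\<Sum>i<n. (z i)\<^sup>2 + 2 * B * z i + B\<^sup>2)"
      proof (rule sum.cong)
        fix i assume "i \<in> {..<n}"
        then have "max (z i - - B) 0 = z i + B" using that[of i] by (auto simp: abs_le_iff)
        then show "(max (z i - - B) 0)\<^sup>2 = (z i)\<^sup>2 + 2 * B * z i + B\<^sup>2"
          by (simp add: power2_eq_square algebra_simps)
      qed simp
      then show ?thesis by (simp add: sum.distrib sum_distrib_left)
    qed
    from this[of x] this[of y] show ?thesis using B total by (simp add: F_def)
  qed
  ultimately show ?thesis by simp
qed

section \<open>Powers and the geometric mean\<close>

lemma unitary_diag_carrier:
  "U \<in> unitary_mats n \<Longrightarrow> U * real_diag n d * mat_adjoint U \<in> carrier_mat n n"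
  using unitary_adjoint[of U n] by auto

lemma unitary_diag_mult:
  assumes "U \<in> unitary_mats n"
  shows "(U * real_diag n d * mat_adjoint U) * (U * real_diag n e * mat_adjoint U)
    = U * real_diag n (\<lambda>i. d i * e i) * mat_adjoint U"
  using unitary_adjoint[OF assms]
  by (simp add: assoc_mult_mat[of _ n n _ n _ n] mult_cancel_inverse_left[OF unitary_adjoint(4)[OF assms]]
      real_diag_mult[symmetric])

lemma unitary_diag_one:
  assumes "U \<in> unitary_mats n" "\<And>i. i < n \<Longrightarrow> d i = 1"
  shows "U * real_diag n d * mat_adjoint U = 1\<^sub>m n"
  using unitary_adjoint[OF assms(1)] by (simp add: real_diag_one[OF assms(2)] right_mult_one_mat[of U n n])

text \<open>In the eigenbasis, commuting means that the entry \<open>(i, j)\<close> vanishes unless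
  \<open>d i = d j\<close>, and then also \<open>f (d i) = f (d j)\<close>.\<close>

lemma unitary_diag_commute:
  assumes U: "U \<in> unitary_mats n" and X: "X \<in> carrier_mat n n"
    and comm: "X * (U * real_diag n d * mat_adjoint U) = U * real_diag n d * mat_adjoint U * X"
  shows "X * (U * real_diag n (\<lambda>i. f (d i)) * mat_adjoint U)
    = U * real_diag n (\<lambda>i. f (d i)) * mat_adjoint U * X"
proof -
  note as = assoc_mult_mat[of _ n n _ n _ n]
  note Uc = unitary_adjoint[OF U]
  define W where "W = mat_adjoint U * X * U"
  have W: "W \<in> carrier_mat n n" using Uc X by (simp add: W_def)
  have left: "X * (U * real_diag n e * mat_adjoint U) = U * (W * real_diag n e) * mat_adjoint U" for e
    using Uc X by (simp add: W_def as mult_cancel_inverse_left[OF Uc(3)])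
  have right: "U * real_diag n e * mat_adjoint U * X = U * (real_diag n e * W) * mat_adjoint U" for e
    using Uc X by (simp add: W_def as mult_cancel_inverse_left[OF Uc(3)])
  have cancel: "mat_adjoint U * (U * M * mat_adjoint U) * U = M" if "M \<in> carrier_mat n n" for M
    using Uc that by (simp add: as mult_cancel_inverse_left[OF Uc(4)])
  have "W * real_diag n d = mat_adjoint U * (U * (W * real_diag n d) * mat_adjoint U) * U"
    by (rule cancel[symmetric]) (use W in simp)
  also have "\<dots> = mat_adjoint U * (U * (real_diag n d * W) * mat_adjoint U) * U"
    using comm unfolding left right by (rule arg_cong)
  also have "\<dots> = real_diag n d * W"
    by (rule cancel) (use W in simp)
  finally have "W * real_diag n d = real_diag n d * W" .
  then have ent: "W $$ (i, j) * complex_of_real (d j) = complex_of_real (d i) * W $$ (i, j)"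
    if "i < n" "j < n" for i j
    using that W by (auto simp: real_diag_def mat_diag_mult_left mat_diag_mult_right
        dest!: arg_cong[where f = "\<lambda>M. M $$ (i, j)"])
  have "W $$ (i, j) * complex_of_real (f (d j)) = complex_of_real (f (d i)) * W $$ (i, j)"
    if "i < n" "j < n" for i j
    using ent[OF that] by (cases "W $$ (i, j) = 0") (auto simp: mult.commute)
  then have "W * real_diag n (\<lambda>i. f (d i)) = real_diag n (\<lambda>i. f (d i)) * W"
    using W by (auto intro!: eq_matI simp: real_diag_def mat_diag_mult_left mat_diag_mult_right)
  then show ?thesis unfolding left right by simp
qed

text \<open>A two-sided inverse guarantees that \<open>mat_inverse\<close> succeeds, and uniqueness
  of inverses identifies its result.\<close>

lemma mat_inv_eq:
  assumes "A \<in> carrier_mat n n" "B \<in> carrier_mat n n" "A * B = 1\<^sub>m n" "B * A = 1\<^sub>m n"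
  shows "mat_inv A = B"
proof -
  have "A \<in> Units (ring_mat TYPE(complex) n ())"
    using assms by (auto simp: Units_def ring_mat_def)
  then obtain C where C: "mat_inverse A = Some C"
    using mat_inverse(1)[OF assms(1), of "()"] by (cases "mat_inverse A") auto
  have AC: "A * C = 1\<^sub>m n" "C \<in> carrier_mat n n"
    using mat_inverse(2)[OF assms(1) C] by auto
  have "C = B * (A * C)"
    using mult_cancel_inverse_left[OF assms(4,2,1) AC(2)] by simp
  then show ?thesis using assms(2) by (simp add: mat_inv_def C AC right_mult_one_mat[of B n n])
qed

lemma mat_rpow_unitary_diag:
  "U \<in> unitary_mats n \<Longrightarrow> mat_rpow (U * real_diag n d * mat_adjoint U) t
    = U * real_diag n (\<lambda>i. d i powr t) * mat_adjoint U"
  by (simp add: mat_rpow_def herm_fun_eq)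

lemma mat_rpow_pos_def:
  assumes "A \<in> pos_def_mats n"
  shows "mat_rpow A t \<in> pos_def_mats n"
proof -
  obtain U a where U: "U \<in> unitary_mats n" and a: "\<And>i. 0 < a i"
    and AU: "A = U * real_diag n a * mat_adjoint U"
    using pos_def_diagonalization[OF assms] by metis
  have "0 < a i powr t" for i using a[of i] by simp
  then show ?thesis
    using pos_def_congruence[OF real_diag_pos_def[of n "\<lambda>i. a i powr t"] unitary_adjoint(2,1,3)[OF U]]
    by (simp add: AU mat_rpow_unitary_diag[OF U])
qed

lemma mat_rpow_add:
  assumes "A \<in> pos_def_mats n"
  shows "mat_rpow A s * mat_rpow A t = mat_rpow A (s + t)"
proof -
  obtain U a where U: "U \<in> unitary_mats n" and "\<And>i. 0 < a i"
    and "A = U * real_diag n a * mat_adjoint U"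
    using pos_def_diagonalization[OF assms] by metis
  then show ?thesis by (simp add: mat_rpow_unitary_diag[OF U] unitary_diag_mult[OF U] powr_add)
qed

lemma mat_rpow_zero_one:
  assumes "A \<in> pos_def_mats n"
  shows "mat_rpow A 0 = 1\<^sub>m n" "mat_rpow A 1 = A"
proof -
  obtain U a where U: "U \<in> unitary_mats n" and a: "\<And>i. 0 < a i"
    and AU: "A = U * real_diag n a * mat_adjoint U"
    using pos_def_diagonalization[OF assms] by metis
  show "mat_rpow A 0 = 1\<^sub>m n"
    unfolding AU mat_rpow_unitary_diag[OF U]
    by (rule unitary_diag_one[OF U]) (use less_imp_neq[OF a] in auto)
  show "mat_rpow A 1 = A"
    unfolding AU mat_rpow_unitary_diag[OF U] using a by (simp add: less_imp_le)
qed

lemma mat_rpow_inv: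
  assumes "A \<in> pos_def_mats n"
  shows "mat_rpow (mat_inv A) t = mat_rpow A (- t)"
proof -
  obtain U a where U: "U \<in> unitary_mats n" and a: "\<And>i. 0 < a i"
    and AU: "A = U * real_diag n a * mat_adjoint U"
    using pos_def_diagonalization[OF assms] by metis
  have inv: "mat_inv A = U * real_diag n (\<lambda>i. 1 / a i) * mat_adjoint U"
    using less_imp_neq[OF a, symmetric] unitary_diag_carrier[OF U]
    by (intro mat_inv_eq[of _ n]) (auto simp: AU unitary_diag_mult[OF U] intro!: unitary_diag_one[OF U])
  have "(1 / a i) powr t = a i powr (- t)" for i
    using a[of i] by (simp add: powr_divide powr_minus_divide)
  then show ?thesis
    by (subst inv) (simp add: AU mat_rpow_unitary_diag[OF U])
qed

lemma mat_rpow_commute: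
  assumes "A \<in> pos_def_mats n" "X \<in> carrier_mat n n" "X * A = A * X"
  shows "X * mat_rpow A t = mat_rpow A t * X"
proof -
  obtain U a where U: "U \<in> unitary_mats n" and "\<And>i. 0 < a i"
    and AU: "A = U * real_diag n a * mat_adjoint U"
    using pos_def_diagonalization[OF assms(1)] by metis
  show ?thesis
    using unitary_diag_commute[OF U assms(2), of a "\<lambda>x. x powr t"] assms(3)
    by (simp only: AU mat_rpow_unitary_diag[OF U])
qed

lemma mat_sqrt_facts:
  assumes A: "A \<in> pos_def_mats n"
  shows "mat_rpow A (1/2) \<in> carrier_mat n n" "mat_rpow A (-1/2) \<in> carrier_mat n n"
    and "mat_adjoint (mat_rpow A (1/2)) = mat_rpow A (1/2)"
    and "mat_adjoint (mat_rpow A (-1/2)) = mat_rpow A (-1/2)"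
    and "mat_rpow A (1/2) * mat_rpow A (-1/2) = 1\<^sub>m n"
    and "mat_rpow A (-1/2) * mat_rpow A (1/2) = 1\<^sub>m n"
    and "mat_rpow A (1/2) * mat_rpow A (1/2) = A"
  using mat_rpow_pos_def[OF A] by (auto simp: pos_def_mats_def mat_rpow_add[OF A] mat_rpow_zero_one[OF A])

text \<open>With \<open>S\<close> the square root of \<open>A\<close>, the inner factors
  \<open>S\<close> cancel in \<open>G * A * G\<close>, and the root \<open>Q\<close> of
  \<open>S * B * S\<close> is squared. If \<open>A\<close> commutes with \<open>B\<close>, it
  commutes with \<open>S * B * S\<close> and hence with \<open>Q\<close>. The comparison of
  distances uses only these facts about the geometric mean.\<close>

lemma geometric_mean_inverse_riccati:
  assumes A: "A \<in> pos_def_mats n" and B: "B \<in> pos_def_mats n"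
  defines "G \<equiv> geometric_mean (mat_inv A) B"
  shows "G \<in> pos_def_mats n" and "G * A * G = B"
    and "A * B = B * A \<Longrightarrow> G * A = A * G"
proof -
  note as = assoc_mult_mat[of _ n n _ n _ n]
  define S where "S = mat_rpow A (1/2)"
  define S' where "S' = mat_rpow A (-1/2)"
  note [simp] = mat_sqrt_facts(1-4)[OF A, folded S_def S'_def]
  note SS' = mat_sqrt_facts(5,6)[OF A, folded S_def S'_def]
  note SS = mat_sqrt_facts(7)[OF A, folded S_def S'_def]
  have c: "A \<in> carrier_mat n n" "B \<in> carrier_mat n n" "S \<in> carrier_mat n n" "S' \<in> carrier_mat n n"
    using A B by (auto simp: pos_def_mats_def)
  define C where "C = S * B * S"
  have C: "C \<in> pos_def_mats n"
    using pos_def_congruence[OF B c(3,4) SS'(2)] by (simp add: C_def)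
  define Q where "Q = mat_rpow C (1/2)"
  note Qc = mat_sqrt_facts(1)[OF C, folded Q_def] and QQ = mat_sqrt_facts(7)[OF C, folded Q_def]
  \<comment> \<open>Inverting \<open>A\<close> flips the signs of the exponents, so \<open>S\<close>
    and \<open>S'\<close> trade places relative to the definition.\<close>
  have GQ: "G = S' * Q * S'"
    unfolding G_def geometric_mean_def by (simp add: mat_rpow_inv[OF A] C_def Q_def S_def S'_def)
  show "G \<in> pos_def_mats n"
    using pos_def_congruence[OF mat_rpow_pos_def[OF C] c(4,3) SS'(1)] by (simp add: GQ Q_def)
  have "G * A * G = S' * (Q * (Q * S'))"
    unfolding GQ SS[symmetric] using c Qc
    by (simp add: as mult_cancel_inverse_left[OF SS'(1)] mult_cancel_inverse_left[OF SS'(2)])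
  also have "\<dots> = S' * C * S'" unfolding QQ[symmetric] using c Qc by (simp add: as)
  also have "\<dots> = B"
    unfolding C_def using c
    by (simp add: as SS' mult_cancel_inverse_left[OF SS'(2)] right_mult_one_mat[of B n n])
  finally show "G * A * G = B" .
  assume AB: "A * B = B * A"
  have SA: "A * S = S * A" "A * S' = S' * A"
    unfolding S_def S'_def by (rule mat_rpow_commute[OF A c(1) refl])+
  have "A * C = C * A"
  proof -
    have "A * C = A * S * B * S" using c by (simp add: C_def as)
    also have "\<dots> = S * (A * B) * S" using c by (simp add: SA as)
    also have "\<dots> = S * B * (A * S)" using c by (simp add: AB as)
    finally show ?thesis using c by (simp add: SA C_def as)
  qed
  then have AQ: "A * Q = Q * A"
    unfolding Q_def by (rule mat_rpow_commute[OF C c(1)])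
  have "A * G = A * S' * Q * S'" using c Qc by (simp add: GQ as)
  also have "\<dots> = S' * (A * Q) * S'" using c Qc by (simp add: SA as)
  also have "\<dots> = S' * Q * (A * S')" using c Qc by (simp add: AQ as)
  finally show "G * A = A * G" using c Qc by (simp add: SA GQ as)
qed

section \<open>Comparison of the two distances\<close>

theorem theorem6p2:
  fixes n :: nat and A B :: "complex mat"
  assumes "A \<in> pos_def_mats n" and "B \<in> pos_def_mats n"
  shows "spectral_dist A B \<le> trace_dist A B \<and>
         (A * B = B * A \<longrightarrow> spectral_dist A B = trace_dist A B)"
proof -
  note as = assoc_mult_mat[of _ n n _ n _ n]
  define G where "G = geometric_mean (mat_inv A) B"
  note ricc = geometric_mean_inverse_riccati[OF assms, folded G_def]
  obtain V g where V: "V \<in> unitary_mats n" and g: "\<And>i. 0 < g i"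
    and GV: "G = V * real_diag n g * mat_adjoint V"
    using pos_def_diagonalization[OF ricc(1)] by metis
  note Vc = unitary_adjoint[OF V]
  have Gc: "G \<in> carrier_mat n n" using ricc(1) by (simp add: pos_def_mats_def)
  have "spectral_dist A B = 2 * sqrt (\<Sum>i<n. (ln (g i))\<^sup>2)"
    unfolding spectral_dist_def G_def[symmetric] mat_log_def GV herm_fun_eq[OF V]
      frobenius_norm_unitary_diag[OF V] ..
  \<comment> \<open>The factor 2 is absorbed into the logarithm, so that the squares of the
    eigenvalues of \<open>G\<close> are compared with those of \<open>P\<close>.\<close>
  also have "\<dots> = sqrt (4 * (\<Sum>i<n. (ln (g i))\<^sup>2))"
    by (simp add: real_sqrt_mult)
  also have "4 * (\<Sum>i<n. (ln (g i))\<^sup>2) = (\<Sum>i<n. (ln ((g i)\<^sup>2))\<^sup>2)"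
    using g by (simp add: sum_distrib_left ln_realpow power_mult_distrib)
  finally have spectral: "spectral_dist A B = sqrt (\<Sum>i<n. (ln ((g i)\<^sup>2))\<^sup>2)" .
  define S where "S = mat_rpow A (1/2)"
  define S' where "S' = mat_rpow A (-1/2)"
  note [simp] = mat_sqrt_facts(1-4)[OF assms(1), folded S_def S'_def]
  note SS' = mat_sqrt_facts(5,6)[OF assms(1), folded S_def S'_def]
  note SS = mat_sqrt_facts(7)[OF assms(1), folded S_def S'_def]
  have c: "A \<in> carrier_mat n n" "B \<in> carrier_mat n n" "S \<in> carrier_mat n n" "S' \<in> carrier_mat n n"
    using assms by (auto simp: pos_def_mats_def)
  define P where "P = S' * B * S'"
  have P: "P \<in> pos_def_mats n"
    using pos_def_congruence[OF assms(2) c(4,3) SS'(1)] by (simp add: P_def)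
  have trace: "trace_dist A B = frobenius_norm (mat_log P)"
    unfolding trace_dist_def P_def S'_def ..
  obtain W s where W: "W \<in> unitary_mats n" and s: "\<And>i. 0 < s i"
    and PW: "P = W * real_diag n s * mat_adjoint W"
    using pos_def_diagonalization[OF P] by metis
  have trace_s: "trace_dist A B = sqrt (\<Sum>i<n. (ln (s i))\<^sup>2)"
    unfolding trace mat_log_def PW herm_fun_eq[OF W] frobenius_norm_unitary_diag[OF W] ..
  \<comment> \<open>The columns of \<open>V\<close> are eigenvectors of \<open>G\<close>, so those
    of \<open>S * V\<close> are eigenvectors of \<open>S * G * S'\<close>, with the same eigenvalues
    \<open>g\<close>.\<close>
  define K where "K = S * V"
  have K: "K \<in> carrier_mat n n" using c Vc by (simp add: K_def)
  have K': "mat_adjoint K = mat_adjoint V * S"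
    using c Vc by (simp add: K_def mat_adjoint_mult[of _ n n _ n])
  have "mat_adjoint V * S' * K = 1\<^sub>m n"
    using c Vc by (simp add: K_def as mult_cancel_inverse_left[OF SS'(2)])
  then have "det (mat_adjoint V * S') * det K = 1"
    using det_mult[of "mat_adjoint V * S'" n K] K c Vc by simp
  then have dK: "det K \<noteq> 0" by auto
  have KPK: "mat_adjoint K * P * K = real_diag n g * (mat_adjoint K * K) * real_diag n g"
  proof -
    have "mat_adjoint K * P * K = mat_adjoint V * B * V"
      using c Vc by (simp add: K_def K'[unfolded K_def] P_def as mult_cancel_inverse_left[OF SS'(1)]
          mult_cancel_inverse_left[OF SS'(2)])
    \<comment> \<open>The Riccati equation enters here; each outer \<open>G\<close> then becomes
      \<open>diag g\<close> against \<open>V\<close>, and the two roots \<open>S\<close> form the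
      Gram matrix of \<open>K\<close>.\<close>
    also have "\<dots> = mat_adjoint V * (G * (S * S) * G) * V"
      by (simp add: ricc(2) SS)
    also have "\<dots> = real_diag n g * (mat_adjoint K * K) * real_diag n g"
      using c Vc by (simp add: GV K_def K'[unfolded K_def] as mult_cancel_inverse_left[OF Vc(4)])
    finally show ?thesis .
  qed
  note clip = clipped_product_le[OF K dK W s g KPK[unfolded PW]]
  have "(\<Sum>i<n. (ln ((g i)\<^sup>2))\<^sup>2) \<le> (\<Sum>i<n. (ln (s i))\<^sup>2)"
  proof (rule sum_squares_majorization)
    have lnprod: "ln (\<Prod>i<n. f i) = (\<Sum>i<n. ln (f i))" if "\<And>i. 0 < f i" for f :: "nat \<Rightarrow> real"
      using less_imp_neq[OF that] by (intro ln_prod) auto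
    have g2: "0 < (g i)\<^sup>2" for i using g[of i] by simp
    show "(\<Sum>i<n. ln ((g i)\<^sup>2)) = (\<Sum>i<n. ln (s i))"
      using clip(2) lnprod[of "\<lambda>i. (g i)\<^sup>2", OF g2] lnprod[of s, OF s] by simp
    fix t :: real
    \<comment> \<open>Clipping commutes with the logarithm, so the products clipped at level
      \<open>exp t\<close> become the hinge sums at \<open>t\<close>.\<close>
    have mx: "max (ln u) t = ln (max u (exp t))" if "0 < u" for u
    proof -
      have "u \<le> exp t \<longleftrightarrow> ln u \<le> t" using that ln_le_cancel_iff[of u "exp t"] by simp
      then show ?thesis by (simp add: max_def)
    qed
    have pos: "0 < max u (exp t)" for u by (simp add: less_max_iff_disj)
    have "ln (\<Prod>i<n. max ((g i)\<^sup>2) (exp t)) \<le> ln (\<Prod>i<n. max (s i) (exp t))"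
      using clip(1)[of "exp t"] by (subst ln_le_cancel_iff) (auto intro!: prod_pos pos)
    then show "(\<Sum>i<n. max (ln ((g i)\<^sup>2)) t) \<le> (\<Sum>i<n. max (ln (s i)) t)"
      using lnprod[of "\<lambda>i. max (f i) (exp t)" for f :: "nat \<Rightarrow> real", OF pos]
      by (simp only: mx[OF g2] mx[OF s])
  qed
  then have "spectral_dist A B \<le> trace_dist A B"
    by (simp add: spectral trace_s)
  moreover have "spectral_dist A B = trace_dist A B" if AB: "A * B = B * A"
  proof -
    have GA: "G * A = A * G" using ricc(3)[OF AB] .
    \<comment> \<open>Commuting \<open>G\<close> past \<open>S'\<close> collapses \<open>P\<close>
      to \<open>G * G\<close>, so the eigenvalues of \<open>P\<close> are exactly the
      \<open>(g i)^2\<close>.\<close>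
    have GS': "G * S' = S' * G"
      unfolding S'_def by (rule mat_rpow_commute[OF assms(1) Gc GA])
    have "P = S' * (G * A * G) * S'" by (simp add: P_def ricc(2))
    also have "\<dots> = S' * G * S * (S * G * S')" using c Gc by (simp add: SS[symmetric] as)
    also have "\<dots> = G * (S' * S) * (S * S' * G)"
      using c Gc by (simp add: GS'[symmetric] as)
    also have "\<dots> = G * G"
      using Gc by (simp add: SS' right_mult_one_mat[of G n n])
    also have "\<dots> = V * real_diag n (\<lambda>i. (g i)\<^sup>2) * mat_adjoint V"
      by (simp add: GV unitary_diag_mult[OF V] power2_eq_square)
    finally have PV: "P = V * real_diag n (\<lambda>i. (g i)\<^sup>2) * mat_adjoint V" .
    show ?thesis
      unfolding spectral trace mat_log_def PV herm_fun_eq[OF V] frobenius_norm_unitary_diag[OF V] ..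
  qed
  ultimately show ?thesis by blast
qed

end
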